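(* Let $A \in \mathbb{R}^{n \times n}$ be invertible with rows $a_1,\dots,a_n \in \mathbb{R}^n$ and let $b \in \mathbb{R}^n$. Consider the problem $\|Ax-b\|_2^2 \rightarrow \min$ and the stochastic gradient descent method which, given the current iterate $x_k \in \mathbb{R}^n$, picks a random index $i \in \{1,\dots,n\}$ with probability $\|a_i\|^2/\|A\|_F^2$ and sets $$ x_{k+1} = x_k + \frac{b_i - \langle a_i, x_k\rangle}{\|a_i\|^2}\, a_i .$$ Set $$ \alpha = \max_{1 \leq i \leq n} \frac{\|A a_i\|^2}{\|a_i\|^2}.$$ Then, for every current iterate $x_k$, where $\mathbb{E}$ denotes expectation over the random choice of $i$ in the step from $x_k$ to $x_{k+1}$, $$ \mathbb{E}\,\|A x_{k+1}- b\|_2^2 \leq \left(1 + \frac{\alpha}{\|A\|_F^2}\right)\|A x_k - b\|_2^2 - \frac{2}{\|A\|_F^2} \left\| A^T (A x_k - b)\right\|_2^2.$$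
   Context: Rows $a_i$ of $A$ are regarded as column vectors in $\mathbb{R}^n$, so $(Ax)_i = \langle a_i, x\rangle$; $\langle\cdot,\cdot\rangle$ is the Euclidean inner product, and $\|\cdot\| = \|\cdot\|_2$ is the Euclidean norm on vectors. $b_i$ is the $i$-th entry of $b$. $\|A\|_F$ is the Frobenius norm, $\|A\|_F^2 = \sum_{i=1}^n \|a_i\|^2$. *)

theory Defs
  imports "HOL-Analysis.Analysis" "HOL-Probability.Probability"
begin

definition frobenius_norm :: "real ^ 'n ^ 'm \<Rightarrow> real" where
  "frobenius_norm A = sqrt (\<Sum>i\<in>UNIV. (norm (row i A))\<^sup>2)"

(* embed_pmf is only specified for weights summing to 1; this holds whenever A is nonzero,
   see pmf_row_index below. *)
definition row_index_pmf :: "real ^ 'n ^ 'm \<Rightarrow> 'm pmf" where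
  "row_index_pmf A = embed_pmf (\<lambda>i. (norm (row i A))\<^sup>2 / (frobenius_norm A)\<^sup>2)"

definition sgd_step :: "real ^ 'n ^ 'm \<Rightarrow> real ^ 'm \<Rightarrow> real ^ 'n \<Rightarrow> 'm \<Rightarrow> real ^ 'n" where
  "sgd_step A b x i = x + ((b $ i - row i A \<bullet> x) / (norm (row i A))\<^sup>2) *\<^sub>R row i A"

definition max_row_ratio :: "real ^ 'n ^ 'n \<Rightarrow> real" where
  "max_row_ratio A = (MAX i\<in>UNIV. (norm (A *v row i A))\<^sup>2 / (norm (row i A))\<^sup>2)"

lemma frobenius_norm_squared: "(frobenius_norm A)\<^sup>2 = (\<Sum>i\<in>UNIV. (norm (row i A))\<^sup>2)"
  by (simp add: frobenius_norm_def sum_nonneg)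

lemma frobenius_norm_nonzero:
  fixes A :: "real ^ 'n ^ 'm"
  assumes "A \<noteq> 0"
  shows "frobenius_norm A \<noteq> 0"
proof
  assume "frobenius_norm A = 0"
  then have "(\<Sum>i\<in>UNIV. (norm (row i A))\<^sup>2) = 0"
    by (simp flip: frobenius_norm_squared)
  then have "\<forall>i. row i A = 0"
    by (simp add: sum_nonneg_eq_0_iff)
  then have "A = 0"
    by (simp add: row_def vec_eq_iff)
  with assms show False by simp
qed

lemma pmf_row_index:
  fixes A :: "real ^ 'n ^ 'm"
  assumes "A \<noteq> 0"
  shows "pmf (row_index_pmf A) i = (norm (row i A))\<^sup>2 / (frobenius_norm A)\<^sup>2"
  unfolding row_index_pmf_def
proof (rule pmf_embed_pmf)
  let ?p = "\<lambda>i. (norm (row i A))\<^sup>2 / (frobenius_norm A)\<^sup>2"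
  have "(\<Sum>i\<in>UNIV. ?p i) = (\<Sum>i\<in>UNIV. (norm (row i A))\<^sup>2) / (frobenius_norm A)\<^sup>2"
    by (rule sum_divide_distrib[symmetric])
  also have "\<dots> = 1"
    using frobenius_norm_nonzero[OF assms] by (simp flip: frobenius_norm_squared)
  finally have "(\<Sum>i\<in>UNIV. ?p i) = 1" .
  then show "(\<integral>\<^sup>+ i. ennreal (?p i) \<partial>count_space UNIV) = 1"
    by (simp add: nn_integral_count_space_finite sum_ennreal)
qed simp

end

theory Submission
  imports Defs
begin

text \<open>
  Write \<open>r = A x - b\<close> for the residual. Since \<open>b\<^sub>i - \<langle>a\<^sub>i, x\<rangle> = - r\<^sub>i\<close>, choosing row \<open>i\<close> moves the
  residual linearly, from \<open>r\<close> to \<open>r - (r\<^sub>i / \<parallel>a\<^sub>i\<parallel>\<^sup>2) A a\<^sub>i\<close>. Expanding the square and multiplying by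
  the weight \<open>\<parallel>a\<^sub>i\<parallel>\<^sup>2\<close> with which row \<open>i\<close> is chosen cancels one factor \<open>\<parallel>a\<^sub>i\<parallel>\<^sup>2\<close> in the
  denominators: the cross term becomes \<open>- 2 r\<^sub>i \<langle>r, A a\<^sub>i\<rangle>\<close>, and the quadratic term becomes
  \<open>r\<^sub>i\<^sup>2 \<parallel>A a\<^sub>i\<parallel>\<^sup>2 / \<parallel>a\<^sub>i\<parallel>\<^sup>2 \<le> \<alpha> r\<^sub>i\<^sup>2\<close>, which is the only inequality in the argument
  (\<open>weighted_residual_after_step_le\<close>).

  Summing over \<open>i\<close>, the quadratic terms give at most \<open>\<alpha> \<parallel>r\<parallel>\<^sup>2\<close>. The cross terms assemble into
  \<open>\<langle>r, A (\<Sum>\<^sub>i r\<^sub>i a\<^sub>i)\<rangle> = \<langle>r, A A\<^sup>T r\<rangle> = \<parallel>A\<^sup>T r\<parallel>\<^sup>2\<close>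
  (\<open>sum_residual_inner_image_of_rows\<close>), and dividing by \<open>\<parallel>A\<parallel>\<^sub>F\<^sup>2\<close> gives the bound.
\<close>

lemma invertible_row_nonzero:
  fixes A :: "real ^ 'n ^ 'n"
  assumes "invertible A"
  shows "row i A \<noteq> 0"
  using assms det_zero_row(2)[of i A] by (auto simp: invertible_det_nz)

lemma transpose_mult_vec_eq_sum_rows:
  fixes A :: "real ^ 'n ^ 'm"
  shows "transpose A *v r = (\<Sum>i\<in>UNIV. r $ i *\<^sub>R row i A)"
  by (simp add: matrix_mult_sum column_transpose scalar_mult_eq_scaleR)

lemma sum_residual_inner_image_of_rows:
  fixes A :: "real ^ 'n ^ 'n"
  shows "(\<Sum>i\<in>UNIV. r $ i * (r \<bullet> (A *v row i A))) = (norm (transpose A *v r))\<^sup>2"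
proof -
  have "(\<Sum>i\<in>UNIV. r $ i * (r \<bullet> (A *v row i A)))
      = (\<Sum>i\<in>UNIV. r $ i * ((transpose A *v r) \<bullet> row i A))"
    by (simp add: dot_lmul_matrix transpose_matrix_vector)
  also have "\<dots> = (transpose A *v r) \<bullet> (\<Sum>i\<in>UNIV. r $ i *\<^sub>R row i A)"
    by (simp add: inner_sum_right)
  also have "\<dots> = (norm (transpose A *v r))\<^sup>2"
    by (simp add: power2_norm_eq_inner flip: transpose_mult_vec_eq_sum_rows)
  finally show ?thesis .
qed

lemma residual_after_step:
  fixes A :: "real ^ 'n ^ 'n"
  shows "A *v sgd_step A b x i - b
       = (A *v x - b) - ((A *v x - b) $ i / (norm (row i A))\<^sup>2) *\<^sub>R (A *v row i A)"
proof -
  have "(A *v x) $ i = row i A \<bullet> x"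
    by (simp add: matrix_vector_mult_def row_def inner_vec_def)
  then show ?thesis
    by (simp add: sgd_step_def matrix_vector_right_distrib matrix_vector_mult_diff_distrib
        matrix_vector_mult_scaleR
        diff_divide_distrib scaleR_diff_left)
qed

lemma row_image_le_max_row_ratio:
  fixes A :: "real ^ 'n ^ 'n"
  shows "(norm (A *v row i A))\<^sup>2 / (norm (row i A))\<^sup>2 \<le> max_row_ratio A"
  unfolding max_row_ratio_def by (rule Max_ge) auto

text \<open>
  Weighting by \<open>\<parallel>a\<^sub>i\<parallel>\<^sup>2\<close> makes the cross term linear in \<open>a\<^sub>i\<close>, so that it can be summed over the
  rows, and leaves the quadratic term with exactly the ratio that \<open>\<alpha>\<close> bounds.
\<close>

lemma weighted_residual_after_step_le:
  fixes A :: "real ^ 'n ^ 'n" and b x :: "real ^ 'n"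
  assumes "row i A \<noteq> 0"
  defines "r \<equiv> A *v x - b"
  shows "(norm (row i A))\<^sup>2 * (norm (A *v sgd_step A b x i - b))\<^sup>2
       \<le> (norm (row i A))\<^sup>2 * (norm r)\<^sup>2 - 2 * (r $ i * (r \<bullet> (A *v row i A)))
         + max_row_ratio A * (r $ i)\<^sup>2"
proof -
  define w where "w = (norm (row i A))\<^sup>2"
  define v where "v = A *v row i A"
  have "w \<noteq> 0"
    using assms(1) by (simp add: w_def)
  have "(norm (A *v sgd_step A b x i - b))\<^sup>2 = (norm (r - (r $ i / w) *\<^sub>R v))\<^sup>2"
    by (simp add: residual_after_step r_def w_def v_def)
  also have "\<dots> = (norm r)\<^sup>2 - 2 * (r $ i / w) * (r \<bullet> v) + (r $ i / w)\<^sup>2 * (norm v)\<^sup>2"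
    unfolding power2_norm_eq_inner
    by (simp add: inner_diff inner_commute power2_eq_square algebra_simps)
  finally have "w * (norm (A *v sgd_step A b x i - b))\<^sup>2
      = w * (norm r)\<^sup>2 - 2 * (r $ i * (r \<bullet> v)) + ((norm v)\<^sup>2 / w) * (r $ i)\<^sup>2"
    using \<open>w \<noteq> 0\<close> by (simp add: field_simps power2_eq_square)
  moreover have "((norm v)\<^sup>2 / w) * (r $ i)\<^sup>2 \<le> max_row_ratio A * (r $ i)\<^sup>2"
    unfolding v_def w_def by (intro mult_right_mono row_image_le_max_row_ratio) simp
  ultimately show ?thesis
    by (simp add: w_def v_def)
qed

lemma expectation_row_index_pmf:
  fixes A :: "real ^ 'n ^ 'm" and f :: "'m \<Rightarrow> real"
  assumes "A \<noteq> 0"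
  shows "measure_pmf.expectation (row_index_pmf A) f
       = (\<Sum>i\<in>UNIV. (norm (row i A))\<^sup>2 * f i) / (frobenius_norm A)\<^sup>2"
proof -
  have "measure_pmf.expectation (row_index_pmf A) f
      = (\<Sum>i\<in>UNIV. pmf (row_index_pmf A) i * f i)"
    by (subst integral_measure_pmf[where A = UNIV]) auto
  then show ?thesis
    by (simp add: pmf_row_index[OF assms] sum_divide_distrib)
qed

theorem theorem1:
  fixes A :: "real ^ 'n ^ 'n" and b x :: "real ^ 'n"
  assumes "invertible A"
  shows "measure_pmf.expectation (row_index_pmf A)
           (\<lambda>i. (norm (A *v sgd_step A b x i - b))\<^sup>2)
         \<le> (1 + max_row_ratio A / (frobenius_norm A)\<^sup>2) * (norm (A *v x - b))\<^sup>2
             - 2 / (frobenius_norm A)\<^sup>2 * (norm (transpose A *v (A *v x - b)))\<^sup>2"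
proof -
  define r where "r = A *v x - b"
  define F where "F = (frobenius_norm A)\<^sup>2"
  have rows: "row i A \<noteq> 0" for i
    by (rule invertible_row_nonzero[OF assms])
  then have "A \<noteq> 0"
    by (auto simp: row_def vec_eq_iff)
  then have "F > 0"
    using frobenius_norm_nonzero[of A] by (simp add: F_def)
  have norm_r: "(\<Sum>i\<in>UNIV. (r $ i)\<^sup>2) = (norm r)\<^sup>2"
    unfolding power2_norm_eq_inner by (simp add: inner_vec_def power2_eq_square)
  have "(\<Sum>i\<in>UNIV. (norm (row i A))\<^sup>2 * (norm (A *v sgd_step A b x i - b))\<^sup>2)
      \<le> (\<Sum>i\<in>UNIV. (norm (row i A))\<^sup>2 * (norm r)\<^sup>2
            - 2 * (r $ i * (r \<bullet> (A *v row i A))) + max_row_ratio A * (r $ i)\<^sup>2)"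
    unfolding r_def by (intro sum_mono weighted_residual_after_step_le rows)
  also have "\<dots> = F * (norm r)\<^sup>2 - 2 * (norm (transpose A *v r))\<^sup>2
      + max_row_ratio A * (norm r)\<^sup>2"
    unfolding F_def
    by (simp add: sum.distrib sum_subtractf frobenius_norm_squared norm_r
        sum_residual_inner_image_of_rows flip: sum_distrib_left sum_distrib_right)
  finally have "measure_pmf.expectation (row_index_pmf A)
        (\<lambda>i. (norm (A *v sgd_step A b x i - b))\<^sup>2)
      \<le> (F * (norm r)\<^sup>2 - 2 * (norm (transpose A *v r))\<^sup>2 + max_row_ratio A * (norm r)\<^sup>2) / F"
    unfolding expectation_row_index_pmf[OF \<open>A \<noteq> 0\<close>] F_def[symmetric]
    using \<open>F > 0\<close> by (intro divide_right_mono) auto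
  also have "\<dots> = (1 + max_row_ratio A / F) * (norm r)\<^sup>2
      - 2 / F * (norm (transpose A *v r))\<^sup>2"
    using \<open>F > 0\<close> by (simp add: field_simps)
  finally show ?thesis
    by (simp add: r_def F_def)
qed

end
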